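(* (Exact quartic-to-Gaussian crossover function.) For $\lambda\ge0$ let $$\mathcal Z(\lambda)=\int_{-\infty}^\infty e^{-x^4-\lambda x^2}\,dx,\qquad \Phi(\lambda)=\frac{1}{\mathcal Z(\lambda)}\int_{-\infty}^\infty (x^4+\lambda x^2)\,e^{-x^4-\lambda x^2}\,dx .$$ Then for $\lambda>0$ $$\mathcal Z(\lambda)=\frac{\sqrt\lambda}{2}\,e^{\lambda^2/8}\,K_{1/4}\!\left(\frac{\lambda^2}{8}\right),$$ and for $\lambda\ge0$ $$\Phi(\lambda)=\frac14-\frac\lambda2\,\frac{d}{d\lambda}\ln\mathcal Z(\lambda),$$ with $\Phi(0)=\frac14$ and $\lim_{\lambda\to\infty}\Phi(\lambda)=\frac12$.
   Context: $K_\nu$ denotes the modified Bessel function of the second kind. $\Phi(\lambda)$ is the normalized mean of the potential $x^4+\lambda x^2$, whose minimum value is $0$ (at $x=0$), with respect to the density proportional to $e^{-x^4-\lambda x^2}$ on $\mathbb R$. *)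

theory Defs
  imports "HOL-Analysis.Analysis"
begin

(* Real order and argument x > 0. The entire function rGamma = 1 / Gamma makes the terms
   at the poles of Gamma vanish, as in the usual convention. *)
definition Bessel_I :: "real \<Rightarrow> real \<Rightarrow> real" where
  "Bessel_I \<nu> x =
     (\<Sum>k. (x / 2) powr (2 * real k + \<nu>) * rGamma (\<nu> + real k + 1) / fact k)"

definition Bessel_K_nonint :: "real \<Rightarrow> real \<Rightarrow> real" where
  "Bessel_K_nonint \<nu> x = pi / 2 * ((Bessel_I (- \<nu>) x - Bessel_I \<nu> x) / sin (\<nu> * pi))"

(* Modified Bessel function of the second kind; integer orders are obtained as limits. *)
definition Bessel_K :: "real \<Rightarrow> real \<Rightarrow> real" where
  "Bessel_K \<nu> x =
     (if \<nu> \<in> \<int> then Lim (at \<nu>) (\<lambda>\<mu>. Bessel_K_nonint \<mu> x) else Bessel_K_nonint \<nu> x)"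

definition quartic_Z :: "real \<Rightarrow> real" where
  "quartic_Z l = (LINT x|lborel. exp (- (x ^ 4) - l * x\<^sup>2))"

definition quartic_Phi :: "real \<Rightarrow> real" where
  "quartic_Phi l =
     1 / quartic_Z l * (LINT x|lborel. (x ^ 4 + l * x\<^sup>2) * exp (- (x ^ 4) - l * x\<^sup>2))"

end

theory Submission
  imports Defs "HOL-Probability.Distributions" "HOL-Real_Asymp.Real_Asymp"
begin

text \<open>
  Let \<open>M n\<close> be the integral of \<open>x ^ (2 * n)\<close> against the quartic weight. Then \<open>d/dl (M n) = - M (n + 1)\<close>,
  and integrating the derivative of \<open>x ^ (2 * n + 1)\<close> times the weight gives
  \<open>(2 * n + 1) * M n = 4 * M (n + 2) + 2 * l * M (n + 1)\<close>. The case \<open>n = 0\<close> yields the formula for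
  \<open>\<Phi>\<close>; together with the case \<open>n = 1\<close> it bounds \<open>M 2 / M 0\<close> by \<open>3 / (4 * l\<^sup>2)\<close>, hence the limit.
  It also shows that \<open>F t = exp (- t\<^sup>2 / 8) * M 0 t\<close> solves \<open>F'' = t\<^sup>2 / 16 * F\<close>. The Bessel side, an
  entire function of \<open>t\<close> once the powers \<open>(t\<^sup>2 / 16) powr (\<plusminus> 1 / 4)\<close> are combined with \<open>sqrt t\<close>,
  solves the same equation, and the initial values agree by the reflection formula for \<open>Gamma\<close>.
\<close>

section \<open>Moments of the quartic weight\<close>

text \<open>Only even powers are indexed, so that differentiating in \<open>l\<close> raises the
  index by exactly one.\<close>

definition quartic_moment :: "nat \<Rightarrow> real \<Rightarrow> real" where
  "quartic_moment n l = (LINT x|lborel. x ^ (2 * n) * exp (- (x ^ 4) - l * x\<^sup>2))"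

text \<open>A Gaussian majorant for every real \<open>l\<close>, negative ones included. With
  \<open>y = x\<^sup>2\<close>, a single term of the exponential series gives
  \<open>y ^ n \<le> fact n * exp y\<close>, and completing the square in \<open>y\<close> absorbs
  the remaining exponent.\<close>

lemma quartic_weight_bound:
  fixes x l :: real
  shows "x ^ (2 * n) * exp (- (x ^ 4) - l * x\<^sup>2)
           \<le> fact n * exp ((1 + \<bar>l\<bar> / 2)\<^sup>2) * exp (- x\<^sup>2)"
proof -
  define y where "y = x\<^sup>2"
  \<comment> \<open>Chosen so that \<open>2 * c * y\<close> dominates the linear part
    \<open>2 * y - l * y\<close>.\<close>
  define c where "c = 1 + \<bar>l\<bar> / 2"
  have "y \<ge> 0" by (simp add: y_def)
  have "(\<Sum>m\<in>{n}. y ^ m /\<^sub>R fact m) \<le> (\<Sum>m. y ^ m /\<^sub>R fact m)"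
    using \<open>y \<ge> 0\<close> by (intro sum_le_suminf summable_exp_generic) auto
  then have "y ^ n \<le> fact n * exp y"
    by (simp add: exp_def field_simps)
  then have "y ^ n * exp (- (y\<^sup>2) - l * y) \<le> fact n * exp y * exp (- (y\<^sup>2) - l * y)"
    by (intro mult_right_mono) auto
  also have "\<dots> = fact n * exp (y - y\<^sup>2 - l * y)"
    by (simp flip: exp_add)
  also have "\<dots> \<le> fact n * exp (c\<^sup>2 - y)"
  proof -
    have "- l * y \<le> \<bar>l\<bar> * y"
      using \<open>y \<ge> 0\<close> by (intro mult_right_mono) auto
    moreover have "0 \<le> (y - c)\<^sup>2"
      by simp
    ultimately have "y - y\<^sup>2 - l * y \<le> c\<^sup>2 - y"
      by (simp add: c_def power2_eq_square algebra_simps)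
    then show ?thesis by simp
  qed
  also have "\<dots> = fact n * exp (c\<^sup>2) * exp (- y)"
    by (simp flip: exp_add)
  finally show ?thesis
    by (simp add: y_def c_def flip: power_mult)
qed

lemma integrable_exp_minus_square: "integrable lborel (\<lambda>x::real. exp (- x\<^sup>2))"
  using has_bochner_integral_even_function[OF gaussian_moment_0]
  by (auto simp: has_bochner_integral_iff)

lemma integrable_quartic_moment:
  "integrable lborel (\<lambda>x::real. x ^ (2 * n) * exp (- (x ^ 4) - l * x\<^sup>2))"
proof (rule Bochner_Integration.integrable_bound)
  show "integrable lborel (\<lambda>x::real. fact n * exp ((1 + \<bar>l\<bar> / 2)\<^sup>2) * exp (- x\<^sup>2))"
    by (intro integrable_mult_right integrable_exp_minus_square)
  show "AE x in lborel. norm (x ^ (2 * n) * exp (- (x ^ 4) - l * x\<^sup>2))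
          \<le> norm (fact n * exp ((1 + \<bar>l\<bar> / 2)\<^sup>2) * exp (- x\<^sup>2))"
    using quartic_weight_bound[of _ n l] by (auto simp: abs_mult)
qed measurable

lemma quartic_moment_parts:
  "(2 * real n + 1) * quartic_moment n l
     = 4 * quartic_moment (n + 2) l + 2 * l * quartic_moment (n + 1) l"
proof -
  let ?w = "\<lambda>x::real. exp (- (x ^ 4) - l * x\<^sup>2)"
  define F where "F = (\<lambda>x. x ^ (2 * n + 1) * ?w x)"
  define f where "f = (\<lambda>x. (2 * real n + 1) * (x ^ (2 * n) * ?w x)
                          - 4 * (x ^ (2 * (n + 2)) * ?w x) - 2 * l * (x ^ (2 * (n + 1)) * ?w x))"
  have int: "integrable lborel f"
    unfolding f_def by (intro Bochner_Integration.integrable_diff integrable_mult_right integrable_quartic_moment)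
  have "integral\<^sup>L lborel f = (2 * real n + 1) * quartic_moment n l
          - 4 * quartic_moment (n + 2) l - 2 * l * quartic_moment (n + 1) l"
    unfolding f_def quartic_moment_def
    by (simp only: Bochner_Integration.integral_diff Bochner_Integration.integrable_diff
          integrable_mult_right integrable_quartic_moment integral_mult_right_zero)
  moreover have "integral\<^sup>L lborel f = 0"
  proof -
    define C where "C = fact n * exp ((1 + \<bar>l\<bar> / 2)\<^sup>2)"
    have bound: "norm (F x) \<le> C * norm (x * exp (- x\<^sup>2))" for x
    proof -
      have "norm (F x) = norm x * (x ^ (2 * n) * ?w x)"
        by (simp add: F_def abs_mult power_mult)
      also have "\<dots> \<le> norm x * (C * exp (- x\<^sup>2))"
        unfolding C_def by (intro mult_left_mono quartic_weight_bound) auto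
      finally show ?thesis by (simp add: abs_mult mult_ac)
    qed
    \<comment> \<open>The boundary terms vanish by the Gaussian majorant. The filter is left
      arbitrary so that one argument serves both ends of the line.\<close>
    have lim: "(F \<longlongrightarrow> 0) A" if "((\<lambda>x::real. x * exp (- x\<^sup>2)) \<longlongrightarrow> 0) A" for A
    proof (rule Lim_null_comparison)
      show "\<forall>\<^sub>F x in A. norm (F x) \<le> C * norm (x * exp (- x\<^sup>2))"
        by (intro always_eventually allI bound)
      show "((\<lambda>x. C * norm (x * exp (- x\<^sup>2))) \<longlongrightarrow> 0) A"
        by (intro tendsto_mult_right_zero tendsto_norm_zero that)
    qed
    have lim_top: "(F \<longlongrightarrow> 0) at_top" and lim_bot: "(F \<longlongrightarrow> 0) at_bot"
      by (rule lim, real_asymp)+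
    \<comment> \<open>\<open>f\<close> is the derivative of \<open>F\<close>, so its integral over
      the line is the difference of the two limits of \<open>F\<close>.\<close>
    have "(LBINT x=-\<infinity>..\<infinity>. f x) = 0 - 0"
    proof (rule interval_integral_FTC_integrable)
      fix x :: real
      have "(F has_real_derivative f x) (at x)"
        unfolding F_def f_def
        by (rule DERIV_cong, (rule derivative_intros)+)
           (simp add: algebra_simps power_add power2_eq_square power3_eq_cube power4_eq_xxxx)
      then show "(F has_vector_derivative f x) (at x)"
        by (simp add: has_real_derivative_iff_has_vector_derivative)
      show "isCont f x"
        unfolding f_def by (intro continuous_intros)
    next
      show "set_integrable lborel (einterval (-\<infinity>) \<infinity>) f"
        using int by (simp add: set_integrable_def einterval_def)
    qed (use lim_top lim_bot in \<open>simp_all add: at_left_PInf at_right_MInf filterlim_filtermap comp_def\<close>)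
    then show ?thesis
      by (simp add: interval_lebesgue_integral_def set_lebesgue_integral_def einterval_def)
  qed
  ultimately show ?thesis by simp
qed

section \<open>Differentiating the moments under the integral sign\<close>

lemma exp_taylor_two_bound:
  fixes y :: real
  shows "\<bar>exp y - 1 - y\<bar> \<le> y\<^sup>2 * exp \<bar>y\<bar>"
proof -
  obtain t where t: "\<bar>t\<bar> \<le> \<bar>y\<bar>" "exp y = (\<Sum>m<2. (y ^ m) / fact m) + (exp t / fact 2) * y ^ 2"
    using Maclaurin_exp_le by blast
  have "exp y - 1 - y = exp t / 2 * y\<^sup>2"
    using t(2) by (simp add: eval_nat_numeral)
  then have "\<bar>exp y - 1 - y\<bar> = \<bar>exp t / 2 * y\<^sup>2\<bar>"
    by (rule arg_cong)
  also have "\<dots> = y\<^sup>2 * (exp t / 2)"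
    by (simp add: abs_mult)
  also have "\<dots> \<le> y\<^sup>2 * exp \<bar>y\<bar>"
  proof (intro mult_left_mono)
    have "exp t \<le> exp \<bar>y\<bar>" using t(1) by auto
    then show "exp t / 2 \<le> exp \<bar>y\<bar>" using exp_gt_zero[of t] by linarith
  qed simp
  finally show ?thesis .
qed

text \<open>The difference quotient misses \<open>D\<close> by at most
  \<open>C * \<bar>h\<bar>\<close>. In this form a derivative under an integral follows from
  integrating a second-order Taylor remainder.\<close>

lemma DERIV_of_quadratic_bound:
  fixes f :: "real \<Rightarrow> real"
  assumes "\<And>h. \<bar>h\<bar> \<le> 1 \<Longrightarrow> \<bar>f (x + h) - f x - h * D\<bar> \<le> C * h\<^sup>2"
  shows "(f has_real_derivative D) (at x)"
proof -
  have "((\<lambda>h. (f (x + h) - f x) / h - D) \<longlongrightarrow> 0) (at 0)"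
  proof (rule Lim_null_comparison)
    show "\<forall>\<^sub>F h in at 0. norm ((f (x + h) - f x) / h - D) \<le> C * \<bar>h\<bar>"
      unfolding eventually_at
    proof (intro exI[of _ 1] conjI ballI impI)
      fix h :: real assume "h \<noteq> 0 \<and> dist h 0 < 1"
      then have h: "h \<noteq> 0" "\<bar>h\<bar> \<le> 1" by auto
      have "(f (x + h) - f x) / h - D = (f (x + h) - f x - h * D) / h"
        using h by (simp add: field_simps)
      then have "norm ((f (x + h) - f x) / h - D) = \<bar>f (x + h) - f x - h * D\<bar> / \<bar>h\<bar>"
        by simp
      also have "\<dots> \<le> C * h\<^sup>2 / \<bar>h\<bar>"
        using assms[OF h(2)] by (intro divide_right_mono) auto
      also have "\<dots> = C * \<bar>h\<bar>"
        using h by (simp add: power2_eq_square field_simps)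
      finally show "norm ((f (x + h) - f x) / h - D) \<le> C * \<bar>h\<bar>" .
    qed simp
    show "((\<lambda>h. C * \<bar>h\<bar>) \<longlongrightarrow> 0) (at 0)"
      by (auto intro!: tendsto_eq_intros)
  qed
  then show ?thesis
    by (simp add: DERIV_def LIM_zero_iff)
qed

lemma DERIV_quartic_moment:
  "(quartic_moment n has_real_derivative - quartic_moment (Suc n) l) (at l)"
proof (rule DERIV_of_quadratic_bound)
  fix h :: real assume h: "\<bar>h\<bar> \<le> 1"
  let ?w = "\<lambda>l x::real. exp (- (x ^ 4) - l * x\<^sup>2)"
  let ?d = "\<lambda>x. x ^ (2 * n) * ?w (l + h) x - x ^ (2 * n) * ?w l x + h * (x ^ (2 * Suc n) * ?w l x)"
  have diff: "quartic_moment n (l + h) - quartic_moment n l - h * (- quartic_moment (Suc n) l)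
        = (LINT x|lborel. ?d x)"
    unfolding quartic_moment_def
    by (simp only: Bochner_Integration.integral_diff Bochner_Integration.integral_add
          Bochner_Integration.integrable_diff integrable_mult_right integrable_quartic_moment
          integral_mult_right_zero)
  have "norm (LINT x|lborel. ?d x) \<le> (LINT x|lborel. h\<^sup>2 * (x ^ (2 * (n + 2)) * ?w (l - 1) x))"
  proof (rule Bochner_Integration.integral_norm_bound_integral)
    show "integrable lborel ?d"
      by (intro Bochner_Integration.integrable_diff Bochner_Integration.integrable_add
          integrable_mult_right integrable_quartic_moment)
    show "integrable lborel (\<lambda>x. h\<^sup>2 * (x ^ (2 * (n + 2)) * ?w (l - 1) x))"
      by (intro integrable_mult_right integrable_quartic_moment)
    fix x :: real
    define y where "y = - h * x\<^sup>2"
    have w: "?w (l + h) x = ?w l x * exp y"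
      by (simp add: y_def flip: exp_add) (simp add: algebra_simps)
    have "?d x = x ^ (2 * n) * ?w l x * (exp y - 1 - y)"
      unfolding w by (simp add: y_def algebra_simps power2_eq_square)
    then have "norm (?d x) = x ^ (2 * n) * ?w l x * \<bar>exp y - 1 - y\<bar>"
      by (simp add: abs_mult power_mult)
    \<comment> \<open>Since \<open>\<bar>h\<bar> \<le> 1\<close>, the factor
      \<open>exp \<bar>y\<bar>\<close> is at most \<open>exp (x\<^sup>2)\<close>, which lowers the
      parameter of the weight from \<open>l\<close> to \<open>l - 1\<close>; the factor
      \<open>y\<^sup>2\<close> contributes \<open>h\<^sup>2\<close> and raises the moment index by
      two.\<close>
    also have "\<dots> \<le> x ^ (2 * n) * ?w l x * (y\<^sup>2 * exp (x\<^sup>2))"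
    proof (intro mult_left_mono)
      have "\<bar>y\<bar> \<le> 1 * x\<^sup>2"
        unfolding y_def abs_mult abs_minus using h by (intro mult_mono) auto
      then have "y\<^sup>2 * exp \<bar>y\<bar> \<le> y\<^sup>2 * exp (x\<^sup>2)"
        by (intro mult_left_mono) auto
      then show "\<bar>exp y - 1 - y\<bar> \<le> y\<^sup>2 * exp (x\<^sup>2)"
        using exp_taylor_two_bound[of y] by linarith
    qed (simp add: power_mult)
    also have "\<dots> = h\<^sup>2 * (x ^ (2 * (n + 2)) * (?w l x * exp (x\<^sup>2)))"
      by (simp add: y_def power_mult_distrib power_add power_mult eval_nat_numeral)
    also have "?w l x * exp (x\<^sup>2) = ?w (l - 1) x"
      by (simp flip: exp_add) (simp add: algebra_simps)
    finally show "norm (?d x) \<le> h\<^sup>2 * (x ^ (2 * (n + 2)) * ?w (l - 1) x)" .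
  qed
  then have "norm (LINT x|lborel. ?d x) \<le> h\<^sup>2 * quartic_moment (n + 2) (l - 1)"
    unfolding quartic_moment_def integral_mult_right_zero .
  then show "\<bar>quartic_moment n (l + h) - quartic_moment n l - h * (- quartic_moment (Suc n) l)\<bar>
      \<le> quartic_moment (n + 2) (l - 1) * h\<^sup>2"
    unfolding diff real_norm_def by (subst mult.commute)
qed

section \<open>\<open>quartic_Z\<close> and \<open>quartic_Phi\<close> in terms of moments\<close>

lemma quartic_moment_nonneg: "quartic_moment n l \<ge> 0"
  unfolding quartic_moment_def by (intro integral_nonneg_AE) (auto simp: power_mult)

lemma quartic_Z_eq: "quartic_Z l = quartic_moment 0 l"
  by (simp add: quartic_Z_def quartic_moment_def)

text \<open>A nonnegative integrand with integral zero vanishes almost everywhere, but the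
  exponential has no zeros and the line is not a null set.\<close>

lemma quartic_Z_pos: "quartic_Z l > 0"
proof -
  have "quartic_Z l \<noteq> 0"
  proof
    assume "quartic_Z l = 0"
    then have "AE x in lborel. exp (- (x ^ 4) - l * x\<^sup>2) = (0::real)"
      unfolding quartic_Z_def
      by (subst (asm) integral_nonneg_eq_0_iff_AE) (use integrable_quartic_moment[of 0 l] in auto)
    then show False
      by (simp add: AE_iff_null null_sets_def)
  qed
  then show ?thesis
    using quartic_moment_nonneg[of 0 l] by (simp add: quartic_Z_eq)
qed

text \<open>Integration by parts with \<open>n = 0\<close> eliminates the second moment, leaving the
  quotient that is minus the logarithmic derivative of \<open>quartic_Z\<close>.\<close>

lemma quartic_Phi_eq:
  "quartic_Phi l = 1 / 4 + l / 2 * (quartic_moment 1 l / quartic_moment 0 l)"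
proof -
  have "(LINT x|lborel. (x ^ 4 + l * x\<^sup>2) * exp (- (x ^ 4) - l * x\<^sup>2))
      = (LINT x|lborel. x ^ (2 * 2) * exp (- (x ^ 4) - l * x\<^sup>2)
                        + l * (x ^ (2 * 1) * exp (- (x ^ 4) - l * x\<^sup>2)))"
    by (simp add: distrib_right mult.assoc)
  also have "\<dots> = quartic_moment 2 l + l * quartic_moment 1 l"
    unfolding quartic_moment_def
    by (simp only: Bochner_Integration.integral_add integrable_mult_right
        integrable_quartic_moment integral_mult_right_zero)
  finally have "quartic_Phi l
      = 1 / quartic_moment 0 l * (quartic_moment 2 l + l * quartic_moment 1 l)"
    by (simp add: quartic_Phi_def quartic_Z_eq)
  moreover have "quartic_moment 0 l = 4 * quartic_moment 2 l + 2 * l * quartic_moment 1 l"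
    using quartic_moment_parts[of 0 l] by (simp add: numeral_2_eq_2)
  ultimately show ?thesis
    using quartic_Z_pos[of l] by (simp add: quartic_Z_eq field_simps)
qed

lemma DERIV_ln_quartic_Z:
  "((\<lambda>t. ln (quartic_Z t)) has_real_derivative - (quartic_moment 1 l / quartic_moment 0 l)) (at l)"
  unfolding quartic_Z_eq
  using quartic_Z_pos[of l] DERIV_quartic_moment[of 0 l]
  by (auto intro!: derivative_eq_intros simp: quartic_Z_eq)

lemma quartic_Phi_tendsto: "(quartic_Phi \<longlongrightarrow> 1 / 2) at_top"
proof -
  have "((\<lambda>l. quartic_Phi l - 1 / 2) \<longlongrightarrow> 0) at_top"
  proof (rule Lim_null_comparison)
    show "\<forall>\<^sub>F l in at_top. norm (quartic_Phi l - 1 / 2) \<le> 3 / (4 * l\<^sup>2)"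
      using eventually_gt_at_top[of 0]
    proof eventually_elim
      case (elim l)
      let ?M = "\<lambda>n. quartic_moment n l"
      have M0: "?M 0 = 4 * ?M 2 + 2 * l * ?M 1"
        using quartic_moment_parts[of 0 l] by (simp add: numeral_2_eq_2)
      have M1: "3 * ?M 1 = 4 * ?M 3 + 2 * l * ?M 2"
        using quartic_moment_parts[of 1 l] by (simp add: numeral_2_eq_2 numeral_3_eq_3)
      have pos: "?M 0 > 0" using quartic_Z_pos by (simp add: quartic_Z_eq)
      \<comment> \<open>Dropping \<open>?M 3\<close> from \<open>M1\<close> bounds
        \<open>?M 2\<close> by \<open>?M 1\<close>; dropping \<open>?M 2\<close> from
        \<open>M0\<close> then bounds \<open>?M 1\<close> by \<open>?M 0\<close>. Each step gains a
        factor of order \<open>1 / l\<close>.\<close>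
      have "2 * l * (2 * l * ?M 2) \<le> 2 * l * (3 * ?M 1)"
        using elim M1 quartic_moment_nonneg[of 3 l] by (intro mult_left_mono) auto
      also have "\<dots> \<le> 3 * ?M 0"
        using M0 quartic_moment_nonneg[of 2 l] by simp
      finally have "?M 2 / ?M 0 \<le> 3 / (4 * l\<^sup>2)"
        using pos elim by (simp add: field_simps power2_eq_square)
      \<comment> \<open>The deviation from the Gaussian value is exactly minus the mean of
        \<open>x ^ 4\<close>.\<close>
      moreover have "quartic_Phi l - 1 / 2 = - (?M 2 / ?M 0)"
        using pos M0 by (simp add: quartic_Phi_eq field_simps)
      moreover have "?M 2 / ?M 0 \<ge> 0"
        using quartic_moment_nonneg by simp
      ultimately show ?case by simp
    qed
    show "((\<lambda>l::real. 3 / (4 * l\<^sup>2)) \<longlongrightarrow> 0) at_top"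
      by real_asymp
  qed
  then show ?thesis by (rule LIM_zero_cancel)
qed

section \<open>The power series of the Bessel functions\<close>

text \<open>The entire factor of \<open>Bessel_I\<close>, taken in the variable
  \<open>w = x\<^sup>2 / 4\<close>: the hypergeometric function 0F1 with parameter
  \<open>\<nu> + 1\<close>, regularized by \<open>rGamma\<close>.\<close>

definition Bessel_series :: "real \<Rightarrow> real \<Rightarrow> real" where
  "Bessel_series \<nu> w = (\<Sum>k. rGamma (real k + \<nu> + 1) / fact k * w ^ k)"

lemma summable_Bessel_series:
  fixes \<nu> w :: real
  shows "summable (\<lambda>k. rGamma (real k + \<nu> + 1) / fact k * w ^ k)"
proof (rule summable_ratio_test)
  \<comment> \<open>From this index on, \<open>\<bar>w\<bar> \<le> (n + 1) / 2\<close> and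
    \<open>\<bar>n + \<nu> + 1\<bar> \<ge> 1\<close>, so consecutive terms shrink at least by the
    factor \<open>1 / 2\<close>.\<close>
  define N where "N = nat \<lceil>\<bar>\<nu>\<bar> + 2 * \<bar>w\<bar>\<rceil>"
  fix n assume "N \<le> n"
  then have n: "\<bar>\<nu>\<bar> + 2 * \<bar>w\<bar> \<le> real n"
    unfolding N_def by linarith
  define r where "r = rGamma (real (Suc n) + \<nu> + 1)"
  have r: "rGamma (real n + \<nu> + 1) = (real n + \<nu> + 1) * r"
    using rGamma_plus1[of "real n + \<nu> + 1"] by (simp add: r_def add_ac)
  have "\<bar>w\<bar> \<le> 1 / 2 * (real n + 1) * 1"
    using n by simp
  also have "\<dots> \<le> 1 / 2 * (real n + 1) * \<bar>real n + \<nu> + 1\<bar>"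
    using n by (intro mult_left_mono) auto
  finally have "\<bar>w\<bar> * (\<bar>r\<bar> * \<bar>w\<bar> ^ n / fact (Suc n))
      \<le> 1 / 2 * (real n + 1) * \<bar>real n + \<nu> + 1\<bar> * (\<bar>r\<bar> * \<bar>w\<bar> ^ n / fact (Suc n))"
    by (intro mult_right_mono) auto
  also have "\<dots> = 1 / 2 * (\<bar>real n + \<nu> + 1\<bar> * \<bar>r\<bar> / fact n * \<bar>w\<bar> ^ n)"
  proof -
    have "1 / 2 * a * b * (c / (a * f)) = 1 / 2 * (b * (c / f))" if "a \<noteq> 0" for a b c f :: real
      using that by simp
    from this[of "real n + 1" "\<bar>real n + \<nu> + 1\<bar>" "\<bar>r\<bar> * \<bar>w\<bar> ^ n" "fact n"] show ?thesis
      by (simp add: add_ac)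
  qed
  finally show "norm (rGamma (real (Suc n) + \<nu> + 1) / fact (Suc n) * w ^ Suc n)
      \<le> 1 / 2 * norm (rGamma (real n + \<nu> + 1) / fact n * w ^ n)"
    unfolding r r_def[symmetric] by (simp add: abs_mult power_abs mult_ac)
qed simp

text \<open>In termwise differentiation the new factor cancels against the factorial, and the index
  shift in \<open>rGamma\<close> becomes a shift of the order.\<close>

lemma DERIV_Bessel_series:
  "(Bessel_series \<nu> has_real_derivative Bessel_series (\<nu> + 1) w) (at w)"
proof -
  have "diffs (\<lambda>k. rGamma (real k + \<nu> + 1) / fact k)
        = (\<lambda>k. rGamma (real k + (\<nu> + 1) + 1) / fact k)"
    by (rule ext) (simp add: diffs_def add_ac)
  with termdiffs_strong_converges_everywhere[OF summable_Bessel_series[of \<nu>], of w]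
  show ?thesis
    by (simp add: Bessel_series_def[abs_def])
qed

text \<open>The functional equation of \<open>rGamma\<close> produces the factor
  \<open>\<nu> + k\<close>, whose two summands give the two terms. As differentiation raises the
  order, this is the equation \<open>w * y'' + \<nu> * y' = y\<close> for
  \<open>y = Bessel_series (\<nu> - 1)\<close>.\<close>

lemma Bessel_series_recurrence:
  "Bessel_series (\<nu> - 1) w = \<nu> * Bessel_series \<nu> w + w * Bessel_series (\<nu> + 1) w"
proof -
  define g where "g = (\<lambda>k. real k * (rGamma (real k + \<nu> + 1) / fact k * w ^ k))"
  have g_Suc: "g (Suc k) = w * (rGamma (real k + (\<nu> + 1) + 1) / fact k * w ^ k)" for k
    proof -
    have "rGamma (real (Suc k) + \<nu> + 1) = rGamma (real k + (\<nu> + 1) + 1)"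
      by (simp add: add_ac)
    then show ?thesis
      by (simp add: g_def mult_ac del: of_nat_Suc)
  qed
  have "(\<lambda>k. g (Suc k)) sums (w * Bessel_series (\<nu> + 1) w)"
    unfolding g_Suc Bessel_series_def
    by (intro sums_mult summable_sums summable_Bessel_series)
  \<comment> \<open>The index shift leaves the sum unchanged because \<open>g 0 = 0\<close>.\<close>
  then have "g sums (w * Bessel_series (\<nu> + 1) w)"
    by (subst (asm) sums_Suc_iff) (simp add: g_def)
  moreover have "(\<lambda>k. \<nu> * (rGamma (real k + \<nu> + 1) / fact k * w ^ k)) sums (\<nu> * Bessel_series \<nu> w)"
    unfolding Bessel_series_def by (intro sums_mult summable_sums summable_Bessel_series)
  ultimately have "(\<lambda>k. \<nu> * (rGamma (real k + \<nu> + 1) / fact k * w ^ k) + g k)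
      sums (\<nu> * Bessel_series \<nu> w + w * Bessel_series (\<nu> + 1) w)"
    by (intro sums_add)
  moreover have "\<nu> * (rGamma (real k + \<nu> + 1) / fact k * w ^ k) + g k
      = rGamma (real k + (\<nu> - 1) + 1) / fact k * w ^ k" for k
  proof -
    have "rGamma (real k + (\<nu> - 1) + 1) = (\<nu> + real k) * rGamma (real k + \<nu> + 1)"
      using rGamma_plus1[of "real k + \<nu>"] by (simp add: add_ac)
    then show ?thesis
      by (simp add: g_def algebra_simps add_divide_distrib)
  qed
  ultimately show ?thesis
    by (simp add: Bessel_series_def sums_iff)
qed

lemma Bessel_series_0: "Bessel_series \<nu> 0 = rGamma (\<nu> + 1)"
  using sums_unique[OF powser_sums_zero[of "\<lambda>k. rGamma (real k + \<nu> + 1) / fact k"]]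
  by (simp add: Bessel_series_def)

lemma Bessel_I_eq:
  assumes "x > 0"
  shows "Bessel_I \<nu> x = (x / 2) powr \<nu> * Bessel_series \<nu> (x\<^sup>2 / 4)"
proof -
  have "(x / 2) powr (2 * real k + \<nu>) = (x / 2) powr \<nu> * (x\<^sup>2 / 4) ^ k" for k
  proof -
    have "(x / 2) powr (2 * real k) = (x / 2) ^ (2 * k)"
      using assms powr_realpow[of "x / 2" "2 * k"] by simp
    also have "\<dots> = (x\<^sup>2 / 4) ^ k"
      by (simp add: power_mult power_divide)
    finally show ?thesis
      by (simp add: powr_add)
  qed
  then have "Bessel_I \<nu> x
      = (\<Sum>k. (x / 2) powr \<nu> * (rGamma (real k + \<nu> + 1) / fact k * (x\<^sup>2 / 4) ^ k))"
    by (simp add: Bessel_I_def add_ac mult_ac)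
  also have "\<dots> = (x / 2) powr \<nu> * Bessel_series \<nu> (x\<^sup>2 / 4)"
    unfolding Bessel_series_def by (rule suminf_mult[OF summable_Bessel_series])
  finally show ?thesis .
qed

section \<open>Comparison of the initial value problems\<close>

lemma linear_second_order_unique:
  fixes y y' q :: "real \<Rightarrow> real"
  assumes y: "\<And>t. (y has_real_derivative y' t) (at t)"
    and y': "\<And>t. (y' has_real_derivative q t * y t) (at t)"
    and q: "\<And>t. 0 \<le> t \<Longrightarrow> t \<le> l \<Longrightarrow> \<bar>q t\<bar> \<le> C"
    and init: "y 0 = 0" "y' 0 = 0" and l: "0 \<le> l"
  shows "y l = 0"
proof -
  \<comment> \<open>The energy \<open>y\<^sup>2 + y'\<^sup>2\<close> grows at most like \<open>exp ((1 + C) * t)\<close>.\<close>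
  define E where "E = (\<lambda>t. ((y t)\<^sup>2 + (y' t)\<^sup>2) * exp (- (1 + C) * t))"
  define E' where "E' = (\<lambda>t. (2 * (1 + q t) * (y t * y' t)
                          - (1 + C) * ((y t)\<^sup>2 + (y' t)\<^sup>2)) * exp (- (1 + C) * t))"
  have "(E has_real_derivative E' t) (at t)" for t
    unfolding E_def E'_def
    by (rule derivative_eq_intros refl y y' | simp)+ (simp add: algebra_simps)
  \<comment> \<open>The rate \<open>1 + C\<close> bounds \<open>\<bar>1 + q t\<bar>\<close>, and
    \<open>2 * \<bar>y t * y' t\<bar>\<close> is at most the energy.\<close>
  moreover have "E' t \<le> 0" if "0 \<le> t" "t \<le> l" for t
  proof -
    have "2 * \<bar>y t * y' t\<bar> \<le> (y t)\<^sup>2 + (y' t)\<^sup>2"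
      using sum_squares_bound[of "\<bar>y t\<bar>" "\<bar>y' t\<bar>"] by (simp add: abs_mult)
    then have "\<bar>1 + q t\<bar> * (2 * \<bar>y t * y' t\<bar>) \<le> (1 + C) * ((y t)\<^sup>2 + (y' t)\<^sup>2)"
      using q[OF that] by (intro mult_mono) auto
    moreover have "(1 + q t) * (2 * (y t * y' t)) \<le> \<bar>1 + q t\<bar> * (2 * \<bar>y t * y' t\<bar>)"
      using abs_ge_self[of "(1 + q t) * (2 * (y t * y' t))"]
      unfolding abs_mult[of "1 + q t"] abs_mult[of 2] by simp
    ultimately have "(1 + q t) * (2 * (y t * y' t)) - (1 + C) * ((y t)\<^sup>2 + (y' t)\<^sup>2) \<le> 0"
      by linarith
    then show ?thesis
      unfolding E'_def by (simp add: mult_le_0_iff mult_ac)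
  qed
  ultimately have "E l \<le> E 0"
    using DERIV_nonpos_imp_nonincreasing[of 0 l E] l by blast
  then have "(y l)\<^sup>2 + (y' l)\<^sup>2 \<le> 0"
    by (simp add: E_def init mult_le_0_iff)
  then show ?thesis
    by (simp add: sum_power2_le_zero_iff)
qed

section \<open>Gamma values for the initial conditions\<close>

lemma Gamma_reflection_real:
  fixes x :: real
  shows "Gamma x * Gamma (1 - x) = pi / sin (pi * x)"
proof -
  have "complex_of_real (Gamma x * Gamma (1 - x)) = Gamma (of_real x) * Gamma (of_real (1 - x))"
    by (simp only: Gamma_complex_of_real of_real_mult)
  also have "of_real (1 - x) = 1 - complex_of_real x"
    by simp
  also have "Gamma (of_real x) * Gamma (1 - complex_of_real x) = of_real (pi / sin (pi * x))"
    by (simp only: Gamma_reflection_complex of_real_divide flip: sin_of_real of_real_mult)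
  finally show ?thesis
    by (simp only: of_real_eq_iff)
qed

text \<open>Substitute \<open>t = x ^ 4\<close> in Euler's integral for \<open>Gamma s\<close> with
  \<open>s = (2 * n + 1) / 4\<close>; the Jacobian supplies the 4 in \<open>?h\<close>, and evenness
  doubles the half-line integral.\<close>

lemma quartic_moment_at_0: "quartic_moment n 0 = Gamma ((2 * real n + 1) / 4) / 2"
proof -
  define s where "s = (2 * real n + 1) / 4"
  have s: "s > 0" by (simp add: s_def)
  let ?f = "\<lambda>t::real. t powr (s - 1) / exp t"
  let ?h = "\<lambda>x::real. 4 * (x ^ (2 * n) * exp (- (x ^ 4)))"
  \<comment> \<open>The origin is removed because for \<open>n = 0\<close> the transformed integrand
    and \<open>?h\<close> differ there.\<close>
  have "(?f has_integral Gamma s) {0<..}"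
    using Gamma_integral_real[OF s]
    by (subst has_integral_spike_set_eq[where T = "{0..}"]) (auto intro: negligible_subset[of "{0}"])
  then have f: "?f absolutely_integrable_on {0<..}" "integral {0<..} ?f = Gamma s"
    by (auto intro!: nonnegative_absolutely_integrable_1 simp: has_integral_iff)
  have img: "(\<lambda>x::real. x ^ 4) ` {0<..} = {0<..}"
  proof (intro equalityI subsetI)
    fix y :: real assume "y \<in> {0<..}"
    then show "y \<in> (\<lambda>x. x ^ 4) ` {0<..}"
      by (intro image_eqI[of _ _ "root 4 y"]) auto
  qed auto
  have inj: "inj_on (\<lambda>x::real. x ^ 4) {0<..}"
    by (rule inj_onI) (use power_eq_imp_eq_base[of _ 4] in force)
  have "(\<lambda>x. \<bar>4 * x ^ 3\<bar> * ?f (x ^ 4)) absolutely_integrable_on {0<..} \<and>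
        integral {0<..} (\<lambda>x. \<bar>4 * x ^ 3\<bar> * ?f (x ^ 4)) = Gamma s"
    using f img
    by (subst has_absolute_integral_change_of_variables_1'[OF _ _ inj])
       (auto intro!: derivative_eq_intros)
  moreover have "\<bar>4 * x ^ 3\<bar> * ?f (x ^ 4) = ?h x" if "x \<in> {0<..}" for x :: real
  proof -
    from that have x: "x > 0" by simp
    have "x ^ 3 * (x ^ 4) powr (s - 1) = x powr 3 * (x powr 4) powr (s - 1)"
      using x powr_realpow[of x 3] powr_realpow[of x 4] by simp
    also have "\<dots> = x powr (3 + 4 * (s - 1))"
      by (simp only: powr_powr powr_add)
    also have "3 + 4 * (s - 1) = real (2 * n)"
      by (simp add: s_def field_simps)
    also have "x powr real (2 * n) = x ^ (2 * n)"
      using x by (rule powr_realpow)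
    finally show ?thesis
      using x by (simp add: exp_minus field_simps)
  qed
  ultimately have h: "integral {0<..} ?h = Gamma s"
    by (metis (no_types, lifting) Henstock_Kurzweil_Integration.integral_cong)
  have int: "integrable lborel ?h"
    using integrable_quartic_moment[of n 0] by simp
  then have "set_integrable lborel {0<..} ?h"
    unfolding set_integrable_def by (intro integrable_mult_indicator) auto
  then have "(LBINT x:{0<..}. ?h x) = Gamma s"
    using h by (simp add: set_borel_integral_eq_integral(2))
  \<comment> \<open>The rule for even functions takes the closed half-line, so the null endpoint is
    put back.\<close>
  moreover have "(LBINT x:{0..}. ?h x) = (LBINT x:{0<..}. ?h x)"
    unfolding set_lebesgue_integral_def
    by (intro integral_cong_AE) (use AE_lborel_singleton[of 0] in \<open>auto simp: indicator_def\<close>)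
  moreover have "integrable lborel (\<lambda>x. indicator {0..} x *\<^sub>R ?h x)"
    using int by (intro integrable_mult_indicator) auto
  ultimately have "has_bochner_integral lborel (\<lambda>x. indicator {0..} x *\<^sub>R ?h x) (Gamma s)"
    by (simp only: has_bochner_integral_iff set_lebesgue_integral_def)
  from has_bochner_integral_even_function[OF this]
  have "integral\<^sup>L lborel ?h = 2 * Gamma s"
    by (simp add: has_bochner_integral_iff)
  then show ?thesis
    by (simp add: quartic_moment_def s_def)
qed

text \<open>The Bessel formula with \<open>sqrt l\<close> multiplied into the bracket: the powers
  \<open>2 / sqrt l\<close> and \<open>sqrt l / 2\<close> become the coefficients \<open>2\<close>
  and \<open>l / 2\<close>, smooth at \<open>l = 0\<close>, where the initial values are
  compared.\<close>

lemma quartic_Z_eq_Bessel_series: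
  assumes "l \<ge> 0"
  defines "w \<equiv> l ^ 4 / 256"
  shows "quartic_Z l = exp (l\<^sup>2 / 8) * (pi / (4 * sin (pi / 4))) *
           (2 * Bessel_series (- 1 / 4) w - l / 2 * Bessel_series (1 / 4) w)"
proof -
  let ?M = quartic_moment
  define P where "P = (\<lambda>\<nu> t. Bessel_series \<nu> (t ^ 4 / 256))"
  define a where "a = pi / (4 * sin (pi / 4))"
  \<comment> \<open>\<open>?M 0\<close> solves \<open>y'' - t / 2 * y' - y / 4 = 0\<close>; the
    Gaussian factor removes the first-order term.\<close>
  define F where "F = (\<lambda>t. exp (- (t\<^sup>2) / 8) * ?M 0 t)"
  define F' where "F' = (\<lambda>t. exp (- (t\<^sup>2) / 8) * (- ?M 1 t - t / 4 * ?M 0 t))"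
  define G where "G = (\<lambda>t. a * (2 * P (- 1 / 4) t - t / 2 * P (1 / 4) t))"
  define G' where
    "G' = (\<lambda>t. a * (t ^ 3 / 32 * P (3 / 4) t - 1 / 2 * P (1 / 4) t - t ^ 4 / 128 * P (5 / 4) t))"
  have dM: "((\<lambda>t. ?M n t) has_real_derivative - ?M (Suc n) t) (at t)" for n t
    by (rule DERIV_quartic_moment)
  have dP: "(P \<nu> has_real_derivative P (\<nu> + 1) t * (t ^ 3 / 64)) (at t)" for \<nu> t
    unfolding P_def
    by (rule DERIV_chain2[OF DERIV_Bessel_series]) (auto intro!: derivative_eq_intros)
  \<comment> \<open>Differentiating \<open>G'\<close> yields orders up to \<open>9 / 4\<close>;
    these relations rewrite \<open>G\<close> in the same orders, so that the two sides can be
    compared.\<close>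
  have rec: "P (- 1 / 4) t = 3 / 4 * P (3 / 4) t + t ^ 4 / 256 * P (7 / 4) t"
    "P (1 / 4) t = 5 / 4 * P (5 / 4) t + t ^ 4 / 256 * P (9 / 4) t" for t
    using Bessel_series_recurrence[of "3 / 4" "t ^ 4 / 256"]
      Bessel_series_recurrence[of "5 / 4" "t ^ 4 / 256"]
    by (simp_all add: P_def)
  have dF: "(F has_real_derivative F' t) (at t)" for t
    unfolding F_def F'_def
    by (auto intro!: derivative_eq_intros dM simp: algebra_simps)
  have dF': "(F' has_real_derivative t\<^sup>2 / 16 * F t) (at t)" for t
  proof -
    \<comment> \<open>Grouped so that the first bracket is the integration-by-parts relation for
      \<open>n = 0\<close> and vanishes.\<close>
    have "(F' has_real_derivative exp (- (t\<^sup>2) / 8) *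
            ((?M 2 t + t / 2 * ?M 1 t - ?M 0 t / 4) + t\<^sup>2 / 16 * ?M 0 t)) (at t)"
      unfolding F'_def
      by (auto intro!: derivative_eq_intros dM simp: field_simps power2_eq_square numeral_2_eq_2)
    moreover have "?M 2 t + t / 2 * ?M 1 t - ?M 0 t / 4 = 0"
      using quartic_moment_parts[of 0 t] by (simp add: numeral_2_eq_2)
    ultimately have "(F' has_real_derivative exp (- (t\<^sup>2) / 8) * (0 + t\<^sup>2 / 16 * ?M 0 t)) (at t)"
      by (simp only:)
    then show ?thesis
      by (rule DERIV_cong) (simp add: F_def)
  qed
  have dG: "(G has_real_derivative G' t) (at t)" for t
    unfolding G_def G'_def
    by (rule DERIV_cong, (rule dP DERIV_cdivide derivative_intros)+)
       (simp add: algebra_simps power3_eq_cube power4_eq_xxxx)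
  have dG': "(G' has_real_derivative t\<^sup>2 / 16 * G t) (at t)" for t
    unfolding G'_def
    by (rule DERIV_cong, (rule dP DERIV_cdivide derivative_intros)+)
       (simp only: G_def rec, simp add: algebra_simps eval_nat_numeral)
  have reflection: "Gamma (1 / 4 :: real) * Gamma (3 / 4) = 4 * a"
    using Gamma_reflection_real[of "1 / 4"] by (simp add: a_def)
  have nz: "Gamma (1 / 4 :: real) \<noteq> 0" "Gamma (3 / 4 :: real) \<noteq> 0"
    by (simp_all add: Gamma_real_pos less_imp_neq[symmetric])
  have a_eq: "a = Gamma (1 / 4) * Gamma (3 / 4) / 4"
    using reflection by simp
  have a: "a * rGamma (3 / 4) = Gamma (1 / 4) / 4" "a * rGamma (1 / 4) = Gamma (3 / 4) / 4"
    by (simp_all add: a_eq rGamma_inverse_Gamma nz)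
  \<comment> \<open>Both values are \<open>Gamma (1 / 4) / 2\<close>; the two derivatives compared
    next are both \<open>- Gamma (3 / 4) / 2\<close>.\<close>
  have "F 0 = G 0"
    using quartic_moment_at_0[of 0] a(1) by (simp add: F_def G_def P_def Bessel_series_0)
  moreover have "F' 0 = G' 0"
  proof -
    have "G' 0 = - (a * rGamma (5 / 4)) / 2"
      by (simp add: G'_def P_def Bessel_series_0)
    also have "rGamma (5 / 4 :: real) = 4 * rGamma (1 / 4)"
      using rGamma_plus1[of "1 / 4 :: real"] by simp
    finally show ?thesis
      using quartic_moment_at_0[of 1] a(2) by (simp add: F'_def)
  qed
  ultimately have init: "F 0 - G 0 = 0" "F' 0 - G' 0 = 0"
    by simp_all
  have "F l - G l = 0"
  proof (rule linear_second_order_unique[where y = "\<lambda>t. F t - G t" and y' = "\<lambda>t. F' t - G' t"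
        and q = "\<lambda>t. t\<^sup>2 / 16" and C = "l\<^sup>2 / 16"])
    show "((\<lambda>t. F t - G t) has_real_derivative F' t - G' t) (at t)" for t
      by (rule DERIV_diff[OF dF dG])
    show "((\<lambda>t. F' t - G' t) has_real_derivative t\<^sup>2 / 16 * (F t - G t)) (at t)" for t
      unfolding right_diff_distrib by (rule DERIV_diff[OF dF' dG'])
    show "\<bar>t\<^sup>2 / 16\<bar> \<le> l\<^sup>2 / 16" if "0 \<le> t" "t \<le> l" for t
      using power_mono[OF that(2,1), of 2] by simp
  qed (use init assms in auto)
  then have "exp (l\<^sup>2 / 8) * F l = exp (l\<^sup>2 / 8) * G l"
    by simp
  moreover have "exp (l\<^sup>2 / 8) * F l = quartic_Z l"
    by (simp add: F_def quartic_Z_eq flip: mult.assoc exp_add)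
  ultimately show ?thesis
    by (simp add: G_def P_def a_def w_def)
qed

lemma quartic_Z_eq_Bessel_K:
  assumes l: "l > 0"
  shows "quartic_Z l = sqrt l / 2 * exp (l\<^sup>2 / 8) * Bessel_K (1 / 4) (l\<^sup>2 / 8)"
proof -
  define w where "w = l ^ 4 / 256"
  have w: "(l\<^sup>2 / 8)\<^sup>2 / 4 = w"
    by (simp add: w_def power_divide flip: power_mult)
  \<comment> \<open>As a fourth power, the base turns the exponents \<open>- 1 / 4\<close> and
    \<open>1 / 4\<close> into \<open>- 1\<close> and \<open>1\<close>.\<close>
  have base: "l\<^sup>2 / 8 / 2 = (sqrt l / 2) powr 4"
    using l by (simp add: powr_numeral power_divide power4_eq_xxxx power2_eq_square)
  have powr: "(l\<^sup>2 / 8 / 2) powr (- 1 / 4) = 2 / sqrt l" "(l\<^sup>2 / 8 / 2) powr (1 / 4) = sqrt l / 2"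
    unfolding base powr_powr using l by (simp_all add: powr_minus)
  \<comment> \<open>Selects the explicit quotient in \<open>Bessel_K\<close> instead of the
    limit.\<close>
  have "(1 / 4 :: real) \<notin> \<int>"
    by (auto elim!: Ints_cases simp: field_simps)
  then have "Bessel_K (1 / 4) (l\<^sup>2 / 8)
      = pi / 2 * ((2 / sqrt l * Bessel_series (- 1 / 4) w - sqrt l / 2 * Bessel_series (1 / 4) w)
          / sin (pi / 4))"
    using l powr by (simp add: Bessel_K_def Bessel_K_nonint_def Bessel_I_eq w)
  then show ?thesis
    using l sin_gt_zero[of "pi / 4"]
    by (simp add: quartic_Z_eq_Bessel_series flip: w_def) (simp add: field_simps)
qed

theorem mainTheorem6:
  shows "(\<forall>l::real. l > 0 \<longrightarrow>
            quartic_Z l = sqrt l / 2 * exp (l\<^sup>2 / 8) * Bessel_K (1 / 4) (l\<^sup>2 / 8)) \<and>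
         (\<forall>l::real. l \<ge> 0 \<longrightarrow>
            (\<exists>D. ((\<lambda>t. ln (quartic_Z t)) has_real_derivative D) (at l within {0..}) \<and>
                 quartic_Phi l = 1 / 4 - l / 2 * D)) \<and>
         quartic_Phi 0 = 1 / 4 \<and>
         (quartic_Phi \<longlongrightarrow> 1 / 2) at_top"
proof (intro conjI allI impI)
  fix l :: real
  show "\<exists>D. ((\<lambda>t. ln (quartic_Z t)) has_real_derivative D) (at l within {0..}) \<and>
          quartic_Phi l = 1 / 4 - l / 2 * D"
    \<comment> \<open>The witness is the two-sided derivative of \<open>ln (quartic_Z t)\<close>;
      restricting it to \<open>{0..}\<close> covers the endpoint as well.\<close>
    by (intro exI[of _ "- (quartic_moment 1 l / quartic_moment 0 l)"] conjI
          has_field_derivative_at_within[OF DERIV_ln_quartic_Z])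
       (simp add: quartic_Phi_eq)
  show "quartic_Phi 0 = 1 / 4"
    by (simp add: quartic_Phi_eq)
qed (simp_all add: quartic_Z_eq_Bessel_K quartic_Phi_tendsto)

end
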